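(* Let $b:[0,T]\times\mathbb{R}^d\to\mathbb{R}^d$ be a bounded measurable vector field satisfying condition (H) with some function $g$, whose distributional divergence $\mathrm{div}(b)$ (in the space variable) exists and satisfies $[\mathrm{div}(b)]^-\in L^1([0,T],L^\infty(\mathbb{R}^d))$. Let $X$ be the unique regular Lagrangian flow associated to $b$. Then for any $R>0$ there is a constant $C$ depending on $R$, $d$ and $g$ (with $b$, $T$ and $\rho$ regarded as fixed; in particular $C$ does not depend on $\varepsilon$) such that for all sufficiently small $\varepsilon>0$ there is a measurable subset $E\subset B(R)$ with $\mathcal{L}^d(B(R)\setminus E)\le\varepsilon$ and, for all $t\in[0,T]$ and all $x,y\in E$, $$|X_t(x)-X_t(y)|\le\psi_{|x-y|}^{-1}(C/\varepsilon).$$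
   Context: Notation: $T>0$; $\mathcal{L}^d$ is Lebesgue measure on $\mathbb{R}^d$; $B(R)$ is the ball in $\mathbb{R}^d$ centered at $0$ with radius $R$; $[\cdot]^-$ denotes the negative part. Fix a function $\rho\in C(\mathbb{R}_+,\mathbb{R}_+)$ which is strictly increasing, with $\rho(0)=0$ and $\int_{0+}\frac{\mathrm{d} s}{\rho(s)}=\infty$. Condition (H): a measurable vector field $b:[0,T]\times\mathbb{R}^d\to\mathbb{R}^d$ satisfies (H) with the function $g$ if $g\in L^1([0,T],L^1_{loc}(\mathbb{R}^d))$ is nonnegative and there are Lebesgue negligible subsets $N_t\subset\mathbb{R}^d$ such that for all $t\in[0,T]$ and all $x,y\notin N_t$, $|b_t(x)-b_t(y)|\le (g_t(x)+g_t(y))\,\rho(|x-y|)$. For $r>0$ define $\psi_r(\xi)=\int_0^\xi\frac{\mathrm{d} s}{\rho(s)+r}$, $\xi\ge0$; $\psi_r^{-1}$ is the inverse function of the strictly increasing function $\psi_r$. Conventions: $\psi_r^{-1}(a)=+\infty$ if $a\geq\sup_{\xi\geq0}\psi_r(\xi)$, and $\psi_0^{-1}(a)=0$ (the case $x=y$, where the inequality is trivial). Regular Lagrangian flow: a map $X:[0,T]\times\mathbb{R}^d\to\mathbb{R}^d$ is a regular Lagrangian flow associated to $b\in L^1_{loc}([0,T]\times\mathbb{R}^d,\mathbb{R}^d)$ if (i) for a.e. $x\in\mathbb{R}^d$, the function $t\mapsto X_t(x)$ is absolutely continuous and satisfies $X_t(x)=x+\int_0^t b_s(X_s(x))\,\mathrm{d}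 s$ for all $t\in[0,T]$; (ii) there is a constant $L>0$ independent of $t\in[0,T]$ such that $(X_t)_\#\mathcal{L}^d\le L\mathcal{L}^d$ for all $t\in[0,T]$, where $(X_t)_\#\mathcal{L}^d$ is the push-forward measure. Under the stated assumptions on $b$ such a flow exists and is unique up to modification of $X_\cdot(x)$ for $x$ in a Lebesgue null set. *)

theory Defs
  imports "HOL-Analysis.Analysis" "HOL-Probability.Essential_Supremum"
begin

(* Functions of (t, x) are curried, and only their values for t in [0,T] matter. Space is an
   arbitrary Euclidean space 'a, d = DIM('a). Measurability is with respect to the Lebesgue
   sigma-algebra. *)

definition spacetime_measurable ::
  "real \<Rightarrow> (real \<Rightarrow> 'a::euclidean_space \<Rightarrow> 'b::euclidean_space) \<Rightarrow> bool" where
  "spacetime_measurable T f \<longleftrightarrow>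
     (\<lambda>(t, x). f t x) \<in> borel_measurable (lebesgue_on ({0..T} \<times> UNIV))"

definition in_L1_L1loc :: "real \<Rightarrow> (real \<Rightarrow> 'a::euclidean_space \<Rightarrow> real) \<Rightarrow> bool" where
  "in_L1_L1loc T f \<longleftrightarrow> spacetime_measurable T f \<and>
     (\<forall>K. compact K \<longrightarrow>
        (\<integral>\<^sup>+t\<in>{0..T}. (\<integral>\<^sup>+x\<in>K. ennreal \<bar>f t x\<bar> \<partial>lebesgue) \<partial>lebesgue) < \<infinity>)"

definition in_L1_Linf :: "real \<Rightarrow> (real \<Rightarrow> 'a::euclidean_space \<Rightarrow> real) \<Rightarrow> bool" where
  "in_L1_Linf T f \<longleftrightarrow> spacetime_measurable T f \<and>
     (\<integral>\<^sup>+t\<in>{0..T}. esssup lebesgue (\<lambda>x. ennreal \<bar>f t x\<bar>) \<partial>lebesgue) < \<infinity>"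

(* Only the behaviour near 0 matters in the last conjunct: the integral over (0,d] is infinite for
   every d > 0 as soon as it is for one. *)
definition osgood_modulus :: "(real \<Rightarrow> real) \<Rightarrow> bool" where
  "osgood_modulus \<rho> \<longleftrightarrow>
     continuous_on {0..} \<rho> \<and> strict_mono_on {0..} \<rho> \<and> (\<forall>s\<ge>0. \<rho> s \<ge> 0) \<and> \<rho> 0 = 0 \<and>
     (\<forall>d>0. (\<integral>\<^sup>+s\<in>{0<..d}. ennreal (1 / \<rho> s) \<partial>lborel) = \<infinity>)"

definition condition_H ::
  "(real \<Rightarrow> real) \<Rightarrow> real \<Rightarrow> (real \<Rightarrow> 'a::euclidean_space \<Rightarrow> 'a) \<Rightarrow> (real \<Rightarrow> 'a \<Rightarrow> real) \<Rightarrow> bool" where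
  "condition_H \<rho> T b g \<longleftrightarrow>
     in_L1_L1loc T g \<and> (\<forall>t\<in>{0..T}. \<forall>x. g t x \<ge> 0) \<and>
     (\<exists>N. (\<forall>t\<in>{0..T}. negligible (N t)) \<and>
          (\<forall>t\<in>{0..T}. \<forall>x y. x \<notin> N t \<longrightarrow> y \<notin> N t \<longrightarrow>
             norm (b t x - b t y) \<le> (g t x + g t y) * \<rho> (norm (x - y))))"

definition psi :: "(real \<Rightarrow> real) \<Rightarrow> real \<Rightarrow> real \<Rightarrow> real" where
  "psi \<rho> r \<xi> = (LINT s:{0..\<xi>}|lborel. 1 / (\<rho> s + r))"

(* Meaningful for r \<ge> 0 and a \<ge> 0 only: for a < 0 the value of the_inv_into is unspecified. *)
definition psi_inv :: "(real \<Rightarrow> real) \<Rightarrow> real \<Rightarrow> real \<Rightarrow> ereal" where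
  "psi_inv \<rho> r a =
     (if r = 0 then 0
      else if ereal a \<ge> (SUP \<xi>\<in>{0..}. ereal (psi \<rho> r \<xi>)) then \<infinity>
      else ereal (the_inv_into {0..} (psi \<rho> r) a))"

fun continuously_differentiable :: "nat \<Rightarrow> ('a::euclidean_space \<Rightarrow> real) \<Rightarrow> bool" where
  "continuously_differentiable 0 f \<longleftrightarrow> continuous_on UNIV f"
| "continuously_differentiable (Suc k) f \<longleftrightarrow>
     (\<forall>x. f differentiable (at x)) \<and>
     (\<forall>i\<in>Basis. continuously_differentiable k (\<lambda>x. frechet_derivative f (at x) i))"

definition test_function :: "('a::euclidean_space \<Rightarrow> real) \<Rightarrow> bool" where
  "test_function \<phi> \<longleftrightarrow>
     (\<forall>k. continuously_differentiable k \<phi>) \<and> compact (closure {x. \<phi> x \<noteq> 0})"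

(* The distributional divergence of v exists as a locally integrable function and equals h.
   The integrand on the left is the inner product of v x with the gradient of phi at x. *)
definition has_distributional_divergence ::
  "('a::euclidean_space \<Rightarrow> 'a) \<Rightarrow> ('a \<Rightarrow> real) \<Rightarrow> bool" where
  "has_distributional_divergence v h \<longleftrightarrow>
     (\<forall>K. compact K \<longrightarrow> set_integrable lebesgue K v \<and> set_integrable lebesgue K h) \<and>
     (\<forall>\<phi>. test_function \<phi> \<longrightarrow>
        (LINT x|lebesgue. frechet_derivative \<phi> (at x) (v x)) = - (LINT x|lebesgue. \<phi> x * h x))"

definition absolutely_continuous_fun :: "real \<Rightarrow> real \<Rightarrow> (real \<Rightarrow> 'a::real_normed_vector) \<Rightarrow> bool" where
  "absolutely_continuous_fun a b f \<longleftrightarrow>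
     (\<forall>e>0. \<exists>d>0. \<forall>I :: (real \<times> real) set.
        finite I \<and> (\<forall>(u, v)\<in>I. a \<le> u \<and> u \<le> v \<and> v \<le> b) \<and>
        pairwise (\<lambda>(u, v) (u', v'). {u<..<v} \<inter> {u'<..<v'} = {}) I \<and>
        (\<Sum>(u, v)\<in>I. v - u) < d \<longrightarrow>
        (\<Sum>(u, v)\<in>I. norm (f v - f u)) < e)"

(* The measurability of X t is what makes the push-forward of Lebesgue measure meaningful, and the
   integrability of s \<mapsto> b s (X s x) what makes the integral equation meaningful (library integrals
   of non-integrable functions are 0). *)
definition regular_lagrangian_flow ::
  "real \<Rightarrow> (real \<Rightarrow> 'a::euclidean_space \<Rightarrow> 'a) \<Rightarrow> (real \<Rightarrow> 'a \<Rightarrow> 'a) \<Rightarrow> bool" where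
  "regular_lagrangian_flow T b X \<longleftrightarrow>
     (AE x in lebesgue.
        absolutely_continuous_fun 0 T (\<lambda>t. X t x) \<and>
        set_integrable lebesgue {0..T} (\<lambda>s. b s (X s x)) \<and>
        (\<forall>t\<in>{0..T}. X t x = x + (LINT s:{0..t}|lebesgue. b s (X s x)))) \<and>
     (\<forall>t\<in>{0..T}. X t \<in> lebesgue \<rightarrow>\<^sub>M borel) \<and>
     (\<exists>L>0. \<forall>t\<in>{0..T}. \<forall>A\<in>sets borel.
        emeasure (distr lebesgue borel (X t)) A \<le> ennreal L * emeasure lborel A)"

end

theory Submission
  imports Defs
begin

text \<open>
  Let \<open>\<Gamma> x\<close> be the integral of \<open>g\<close> along the trajectory of \<open>x\<close>. As \<open>b\<close> is bounded by some \<open>M\<close>,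
  trajectories from the ball \<open>B(R)\<close> stay in the ball of radius \<open>R + T M\<close>, and the compression bound
  \<open>L\<close> of the flow gives that the integral of \<open>\<Gamma>\<close> over \<open>B(R)\<close> is at most \<open>L\<close> times the integral of \<open>g\<close> over
  \<open>[0, T]\<close> times the larger ball (\<open>compressible_flow_integral\<close>). Let \<open>K > 0\<close> be such a bound. By the
  Markov inequality the set \<open>E\<close> of the points of \<open>B(R)\<close> with \<open>\<Gamma> x \<le> K / \<epsilon>\<close> omits measure at most \<open>\<epsilon>\<close>.

  For two points \<open>x\<close>, \<open>y\<close> of \<open>E\<close> at distance \<open>r > 0\<close>, condition (H) says that \<open>X t x - X t y\<close> moves with
  speed at most \<open>(g t (X t x) + g t (X t y)) \<rho>(|X t x - X t y|)\<close>. A Bihari inequality (\<open>psi_bihari\<close>)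
  then bounds \<open>psi \<rho> r |X t x - X t y|\<close> by \<open>psi \<rho> r r + \<Gamma> x + \<Gamma> y \<le> 1 + 2 K / \<epsilon>\<close>, and inverting \<open>psi\<close>
  gives the claim with \<open>C = 2 K + 1\<close> for \<open>\<epsilon> < 1\<close>.

  Condition (H) must be available along almost every trajectory at almost every time, although its
  null sets are chosen separately for each time. They are replaced by the sections of a single Borel
  set (\<open>condition_H_borel_exceptional_set\<close>), which the compression bound and Fubini's theorem show to
  be avoided (\<open>compressible_flow_avoids_null_sets\<close>). Fubini's theorem needs a jointly measurable
  version of the flow (\<open>regular_lagrangian_flow_version\<close>).
\<close>

section \<open>The functions psi and their inverses\<close>

lemma osgood_modulus_nonneg: "osgood_modulus \<rho> \<Longrightarrow> 0 \<le> s \<Longrightarrow> 0 \<le> \<rho> s"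
  unfolding osgood_modulus_def by auto

lemma psi_integrable:
  assumes \<rho>: "osgood_modulus \<rho>" and r: "r > 0" and a: "0 \<le> a"
  shows "(\<lambda>s. 1 / (\<rho> s + r)) integrable_on {a..b}"
proof -
  have cont: "continuous_on {a..b} \<rho>"
    using \<rho> a unfolding osgood_modulus_def by (auto intro: continuous_on_subset)
  have "\<forall>s\<in>{a..b}. \<rho> s + r \<noteq> 0"
    using osgood_modulus_nonneg[OF \<rho>] r a by (force simp: add_nonneg_eq_0_iff)
  then have "continuous_on {a..b} (\<lambda>s. 1 / (\<rho> s + r))"
    by (intro continuous_intros cont) auto
  then show ?thesis
    by (rule integrable_continuous_real)
qed

lemma psi_eq_integral:
  assumes \<rho>: "osgood_modulus \<rho>" and r: "r > 0"
  shows "psi \<rho> r \<xi> = integral {0..\<xi>} (\<lambda>s. 1 / (\<rho> s + r))"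
proof -
  have cont: "continuous_on {0..\<xi>} \<rho>"
    using \<rho> unfolding osgood_modulus_def by (auto intro: continuous_on_subset)
  have "\<forall>s\<in>{0..\<xi>}. \<rho> s + r \<noteq> 0"
    using osgood_modulus_nonneg[OF \<rho>] r by (force simp: add_nonneg_eq_0_iff)
  then have "continuous_on {0..\<xi>} (\<lambda>s. 1 / (\<rho> s + r))"
    by (intro continuous_intros cont) auto
  then have "set_integrable lborel {0..\<xi>} (\<lambda>s. 1 / (\<rho> s + r))"
    by (rule borel_integrable_atLeastAtMost')
  then show ?thesis
    unfolding psi_def by (rule set_borel_integral_eq_integral(2))
qed

lemma osgood_modulus_mono:
  assumes "osgood_modulus \<rho>" "0 \<le> a" "a \<le> b"
  shows "\<rho> a \<le> \<rho> b"
  using assms strict_mono_on_leD[of "{0..}" \<rho> a b] unfolding osgood_modulus_def by auto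

text \<open>The increments of \<open>psi\<close> are controlled by the extreme values of its monotone integrand. This
  takes the place of derivatives in all estimates below.\<close>

lemma psi_diff_bounds:
  assumes \<rho>: "osgood_modulus \<rho>" and r: "r > 0" and ab: "0 \<le> a" "a \<le> b"
  shows "(b - a) / (\<rho> b + r) \<le> psi \<rho> r b - psi \<rho> r a"
    and "psi \<rho> r b - psi \<rho> r a \<le> (b - a) / (\<rho> a + r)"
proof -
  let ?f = "\<lambda>s. 1 / (\<rho> s + r)"
  have "integral {0..a} ?f + integral {a..b} ?f = integral {0..b} ?f"
    using ab by (intro Henstock_Kurzweil_Integration.integral_combine psi_integrable \<rho> r) auto
  then have eq: "psi \<rho> r b - psi \<rho> r a = integral {a..b} ?f"
    by (simp add: psi_eq_integral \<rho> r)
  have int: "?f integrable_on {a..b}"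
    by (rule psi_integrable[OF \<rho> r ab(1)])
  have b: "?f b \<le> ?f s \<and> ?f s \<le> ?f a" if "s \<in> {a..b}" for s
    using that ab r osgood_modulus_mono[OF \<rho>, of a s] osgood_modulus_mono[OF \<rho>, of s b]
      osgood_modulus_nonneg[OF \<rho>, of a]
    by (auto intro!: divide_left_mono mult_pos_pos)
  have "integral {a..b} (\<lambda>s. ?f b) \<le> integral {a..b} ?f"
    using b int by (intro integral_le) auto
  then show "(b - a) / (\<rho> b + r) \<le> psi \<rho> r b - psi \<rho> r a"
    unfolding eq using ab by simp
  have "integral {a..b} ?f \<le> integral {a..b} (\<lambda>s. ?f a)"
    using b int by (intro integral_le) auto
  then show "psi \<rho> r b - psi \<rho> r a \<le> (b - a) / (\<rho> a + r)"
    unfolding eq using ab by simp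
qed

lemma psi_0: "osgood_modulus \<rho> \<Longrightarrow> r > 0 \<Longrightarrow> psi \<rho> r 0 = 0"
  by (simp add: psi_eq_integral)

lemma psi_strict_mono:
  assumes \<rho>: "osgood_modulus \<rho>" and r: "r > 0"
  shows "strict_mono_on {0..} (psi \<rho> r)"
proof (rule strict_mono_onI)
  fix a b :: real assume ab: "a \<in> {0..}" "b \<in> {0..}" "a < b"
  have "0 < (b - a) / (\<rho> b + r)"
    using ab r osgood_modulus_nonneg[OF \<rho>, of b] by (intro divide_pos_pos) auto
  then show "psi \<rho> r a < psi \<rho> r b"
    using psi_diff_bounds(1)[OF \<rho> r, of a b] ab by auto
qed

lemma psi_continuous:
  assumes \<rho>: "osgood_modulus \<rho>" and r: "r > 0"
  shows "continuous_on {0..b} (psi \<rho> r)"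
  using indefinite_integral_continuous_1[OF psi_integrable[OF \<rho> r order_refl], of b]
  by (simp add: psi_eq_integral[OF \<rho> r, abs_def])

text \<open>A bound on \<open>psi\<close> gives a bound by \<open>psi_inv\<close>; when \<open>a\<close> is not below the supremum of \<open>psi\<close>,
  the right-hand side is infinite.\<close>

lemma le_psi_inv:
  assumes \<rho>: "osgood_modulus \<rho>" and r: "r > 0" and z: "0 \<le> z" and le: "psi \<rho> r z \<le> a"
  shows "ereal z \<le> psi_inv \<rho> r a"
proof (cases "ereal a \<ge> (SUP \<xi>\<in>{0..}. ereal (psi \<rho> r \<xi>))")
  case True
  then show ?thesis using r by (simp add: psi_inv_def)
next
  case False
  then obtain \<zeta> where \<zeta>: "\<zeta> \<ge> 0" "a < psi \<rho> r \<zeta>"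
    by (auto simp: not_le less_SUP_iff)
  note sm = psi_strict_mono[OF \<rho> r]
  have "psi \<rho> r 0 \<le> psi \<rho> r z"
    using z by (intro strict_mono_on_leD[OF sm]) auto
  then have "psi \<rho> r 0 \<le> a" using le by simp
  then obtain \<xi> where \<xi>: "0 \<le> \<xi>" "psi \<rho> r \<xi> = a"
    using IVT'[of "psi \<rho> r" 0 a \<zeta>] \<zeta> psi_continuous[OF \<rho> r] by auto
  have "the_inv_into {0..} (psi \<rho> r) a = \<xi>"
    using \<xi> sm by (intro the_inv_into_f_eq strict_mono_on_imp_inj_on) auto
  moreover have "z \<le> \<xi>"
    using le \<xi> z strict_mono_onD[OF sm, of \<xi> z] by force
  ultimately show ?thesis
    using False r by (simp add: psi_inv_def)
qed

text \<open>The integrand is at most \<open>1 / r\<close>, so starting at distance \<open>r\<close> costs at most \<open>1\<close>, uniformly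
  in \<open>r\<close>. This is what makes the final constant independent of the two points.\<close>

lemma psi_self_le_1:
  assumes \<rho>: "osgood_modulus \<rho>" and r: "r > 0"
  shows "psi \<rho> r r \<le> 1"
proof -
  have "\<rho> 0 = 0" using \<rho> by (simp add: osgood_modulus_def)
  then show ?thesis
    using psi_diff_bounds(2)[OF \<rho> r, of 0 r] r psi_0[OF \<rho> r] by simp
qed

section \<open>A Bihari inequality\<close>

text \<open>The Bihari inequality for an integral curve \<open>u\<close> whose velocity is at most
  \<open>h s * \<rho> (norm (u s))\<close>. The chain rule for absolutely continuous functions is avoided: \<open>norm (u t)\<close>
  is bounded by \<open>w t\<close>, the initial norm plus the length of the curve up to \<open>t\<close>, which is nondecreasing.
  On any interval \<open>[a, c]\<close> the length is at most \<open>\<rho> (w c)\<close> times the integral of \<open>h\<close>, while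
  \<open>psi \<rho> r (w c) - psi \<rho> r (w a)\<close> is at most the length divided by \<open>\<rho> (w a) + r\<close>. If the interval is
  so short that \<open>\<rho> (w c) \<le> \<rho> (w a) + r\<close>, which uses \<open>r > 0\<close>, then the increment of \<open>psi\<close> is at
  most the integral of \<open>h\<close>. These inequalities add up over adjacent intervals.\<close>

lemma psi_bihari:
  fixes u v :: "real \<Rightarrow> 'a::euclidean_space"
  assumes \<rho>: "osgood_modulus \<rho>" and r: "r > 0"
    and v: "set_integrable lebesgue {0..T} v"
    and h: "set_integrable lebesgue {0..T} h" "\<And>s. s \<in> {0..T} \<Longrightarrow> 0 \<le> h s"
    and u: "\<And>t. t \<in> {0..T} \<Longrightarrow> u t = u0 + (LINT s:{0..t}|lebesgue. v s)"
    and vh: "AE s in lebesgue. s \<in> {0..T} \<longrightarrow> norm (v s) \<le> h s * \<rho> (norm (u s))"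
    and t: "t \<in> {0..T}"
  shows "psi \<rho> r (norm (u t)) \<le> psi \<rho> r (norm u0) + (LINT s:{0..T}|lebesgue. h s)"
proof -
  let ?n = "\<lambda>s. norm (v s)"
  have nv: "set_integrable lebesgue {0..T} ?n"
    using v by (rule set_integrable_norm)
  \<comment> \<open>Both integrals are used: the Lebesgue integral for comparison almost everywhere, the
     Henstock-Kurzweil integral for additivity and continuity in the interval.\<close>
  have eq: "(LINT s:{a..c}|lebesgue. f s) = integral {a..c} f"
      "f integrable_on {a..c}"
    if "set_integrable lebesgue {0..T} f" "0 \<le> a" "c \<le> T" for f :: "real \<Rightarrow> real" and a c
  proof -
    have "set_integrable lebesgue {a..c} f"
      using that by (auto intro: set_integrable_subset)
    then show "(LINT s:{a..c}|lebesgue. f s) = integral {a..c} f" "f integrable_on {a..c}"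
      by (auto dest: set_lebesgue_integral_eq_integral)
  qed
  define w where "w t = norm u0 + integral {0..t} ?n" for t
  have uw: "norm (u s) \<le> w s" if s: "s \<in> {0..T}" for s
  proof -
    have "set_integrable lebesgue {0..s} v"
      using v s by (auto intro: set_integrable_subset)
    then have "norm (LINT s:{0..s}|lebesgue. v s) \<le> (LINT s:{0..s}|lebesgue. ?n s)"
      by (rule set_integral_norm_bound)
    then show ?thesis
      using u[OF s] norm_triangle_ineq[of u0 "LINT s:{0..s}|lebesgue. v s"] s eq(1)[OF nv, of 0 s]
      by (simp add: w_def)
  qed
  have wd: "w c - w a = integral {a..c} ?n" "0 \<le> integral {a..c} ?n"
    if "0 \<le> a" "a \<le> c" "c \<le> T" for a c
  proof -
    have "integral {0..a} ?n + integral {a..c} ?n = integral {0..c} ?n"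
      using that by (intro Henstock_Kurzweil_Integration.integral_combine eq(2)[OF nv]) auto
    then show "w c - w a = integral {a..c} ?n" by (simp add: w_def)
    show "0 \<le> integral {a..c} ?n"
      using that by (intro integral_nonneg eq(2)[OF nv]) auto
  qed
  have w0: "0 \<le> w s" if "s \<in> {0..T}" for s
    using uw[OF that] by (rule order_trans[OF norm_ge_zero])
  have wmono: "w a \<le> w c" if "0 \<le> a" "a \<le> c" "c \<le> T" for a c
    using wd[OF that] by simp
  have wcont: "continuous_on {0..T} w"
    unfolding w_def by (intro continuous_intros indefinite_integral_continuous_1 eq(2)[OF nv]) auto
  have \<rho>wcont: "continuous_on {0..T} (\<lambda>s. \<rho> (w s))"
  proof (rule continuous_on_compose2[OF _ wcont])
    show "continuous_on {0..} \<rho>" using \<rho> by (simp add: osgood_modulus_def)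
  qed (use w0 in auto)
  have step: "integral {a..c} ?n \<le> integral {a..c} h * \<rho> (w c)" if "0 \<le> a" "a \<le> c" "c \<le> T" for a c
  proof -
    have "(LINT s:{a..c}|lebesgue. ?n s) \<le> (LINT s:{a..c}|lebesgue. h s * \<rho> (w c))"
    proof (rule set_integral_mono_AE)
      show "set_integrable lebesgue {a..c} ?n"
        using nv that by (auto intro: set_integrable_subset)
      show "set_integrable lebesgue {a..c} (\<lambda>s. h s * \<rho> (w c))"
        using h(1) that by (intro set_integrable_mult_left) (auto intro: set_integrable_subset)
      show "AE s\<in>{a..c} in lebesgue. ?n s \<le> h s * \<rho> (w c)"
        using vh
      proof eventually_elim
        case (elim s)
        show ?case
        proof
          assume s: "s \<in> {a..c}"
          then have "s \<in> {0..T}" using that by auto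
          have "\<rho> (norm (u s)) \<le> \<rho> (w c)"
            using uw[of s] wmono[of s c] s that by (intro osgood_modulus_mono[OF \<rho>]) auto
          then have "h s * \<rho> (norm (u s)) \<le> h s * \<rho> (w c)"
            by (rule mult_left_mono) (use h(2) \<open>s \<in> {0..T}\<close> in auto)
          then show "?n s \<le> h s * \<rho> (w c)"
            using elim \<open>s \<in> {0..T}\<close> by auto
        qed
      qed
    qed
    also have "(LINT s:{a..c}|lebesgue. h s * \<rho> (w c)) = (LINT s:{a..c}|lebesgue. h s) * \<rho> (w c)"
      by simp
    finally show ?thesis
      using that by (simp add: eq(1)[OF nv] eq(1)[OF h(1)])
  qed
  have "psi \<rho> r (w t) \<le> psi \<rho> r (w 0) + integral {0..t} h"
  proof -
    define P where "P a c \<longleftrightarrow> 0 \<le> a \<and> a \<le> c \<and> c \<le> T \<longrightarrow> psi \<rho> r (w c) \<le> psi \<rho> r (w a) + integral {a..c} h" for a c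
    have "P 0 t"
    proof (rule Bolzano)
      show "0 \<le> t" using t by simp
      fix a b c assume *: "P a b" "P b c" "a \<le> b" "b \<le> c"
      show "P a c"
        unfolding P_def
      proof
        assume ac: "0 \<le> a \<and> a \<le> c \<and> c \<le> T"
        then have "integral {a..b} h + integral {b..c} h = integral {a..c} h"
          using * by (intro Henstock_Kurzweil_Integration.integral_combine eq(2)[OF h(1)]) auto
        then show "psi \<rho> r (w c) \<le> psi \<rho> r (w a) + integral {a..c} h"
          using * ac by (simp add: P_def)
      qed
    next
      fix x assume x: "0 \<le> x" "x \<le> t"
      then have "x \<in> {0..T}" using t by auto
      then obtain d where d: "d > 0" "\<And>y. y \<in> {0..T} \<Longrightarrow> dist y x < d \<Longrightarrow> dist (\<rho> (w y)) (\<rho> (w x)) < r / 2"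
        using \<rho>wcont r unfolding continuous_on_iff by (metis half_gt_zero)
      show "\<exists>d>0. \<forall>a b. a \<le> x \<and> x \<le> b \<and> b - a < d \<longrightarrow> P a b"
      proof (intro exI[of _ d] conjI allI impI d(1))
        fix a c assume ac: "a \<le> x \<and> x \<le> c \<and> c - a < d"
        show "P a c"
          unfolding P_def
        proof
          assume i: "0 \<le> a \<and> a \<le> c \<and> c \<le> T"
          have "dist (\<rho> (w a)) (\<rho> (w x)) < r / 2" "dist (\<rho> (w c)) (\<rho> (w x)) < r / 2"
            using d(2)[of a] d(2)[of c] ac i by (auto simp: dist_real_def)
          then have close: "\<rho> (w c) \<le> \<rho> (w a) + r"
            unfolding dist_real_def by linarith
          have pos: "0 < \<rho> (w a) + r"
            using r osgood_modulus_nonneg[OF \<rho> w0, of a] i by auto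
          have h0: "0 \<le> integral {a..c} h"
            using i h(2) by (intro integral_nonneg eq(2)[OF h(1)]) auto
          have "psi \<rho> r (w c) - psi \<rho> r (w a) \<le> (w c - w a) / (\<rho> (w a) + r)"
            using i by (intro psi_diff_bounds \<rho> r w0 wmono) auto
          also have "\<dots> \<le> (integral {a..c} h * \<rho> (w c)) / (\<rho> (w a) + r)"
            using i step[of a c] wd[of a c] pos by (intro divide_right_mono) auto
          also have "\<dots> \<le> (integral {a..c} h * (\<rho> (w a) + r)) / (\<rho> (w a) + r)"
            using close h0 pos by (intro divide_right_mono mult_left_mono) auto
          also have "\<dots> = integral {a..c} h" using pos by simp
          finally show "psi \<rho> r (w c) \<le> psi \<rho> r (w a) + integral {a..c} h" by simp
        qed
      qed
    qed
    then show ?thesis using t by (simp add: P_def)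
  qed
  moreover have "w 0 = norm u0" by (simp add: w_def)
  moreover have "psi \<rho> r (norm (u t)) \<le> psi \<rho> r (w t)"
    using uw[OF t] w0[OF t] by (intro strict_mono_on_leD[OF psi_strict_mono[OF \<rho> r]]) auto
  moreover have "integral {0..t} h \<le> integral {0..T} h"
    using t h by (intro integral_subset_le eq(2)[OF h(1)]) auto
  ultimately show ?thesis
    using eq(1)[OF h(1), of 0 T] by simp
qed

section \<open>A Borel exceptional set for condition (H)\<close>

text \<open>A Lebesgue measurable field on \<open>[0, T]\<close> times space agrees almost everywhere with a Borel one, so
  that it can be composed with measurable maps and cut into sections.\<close>

lemma spacetime_borel_version:
  fixes f :: "real \<Rightarrow> 'a::euclidean_space \<Rightarrow> 'b::euclidean_space"
  assumes f: "spacetime_measurable T f"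
  shows "\<exists>f'\<in>borel_measurable borel.
           AE p in lborel. fst p \<in> {0..T} \<longrightarrow> f (fst p) (snd p) = f' p"
proof -
  let ?S = "{0..T} \<times> (UNIV :: 'a set)"
  let ?F = "\<lambda>p. if p \<in> ?S then f (fst p) (snd p) else 0"
  have "closed ?S" by (intro closed_Times) auto
  then have "?S \<in> sets lebesgue" by (auto intro: lborelD)
  then have F: "?F \<in> borel_measurable lebesgue"
    using f by (subst borel_measurable_if) (auto simp: spacetime_measurable_def case_prod_beta')
  have "\<forall>i\<in>Basis. \<exists>h\<in>borel_measurable lborel. AE p in lborel. ?F p \<bullet> i = h p"
    using F by (intro ballI completion_ex_borel_measurable_real) auto
  then obtain h where "\<forall>i\<in>Basis. h i \<in> borel_measurable lborel \<and> (AE p in lborel. ?F p \<bullet> i = h i p)"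
    unfolding Bex_def by (rule bchoice[THEN exE])
  then have h: "\<And>i. i \<in> Basis \<Longrightarrow> h i \<in> borel_measurable lborel"
      "\<And>i. i \<in> Basis \<Longrightarrow> AE p in lborel. ?F p \<bullet> i = h i p"
    by auto
  have "AE p in lborel. \<forall>i\<in>Basis. ?F p \<bullet> i = h i p"
    using h(2) by (intro AE_finite_allI) auto
  then have "AE p in lborel. fst p \<in> {0..T} \<longrightarrow> f (fst p) (snd p) = (\<Sum>i\<in>Basis. h i p *\<^sub>R i)"
  proof eventually_elim
    case (elim p)
    have "?F p = (\<Sum>i\<in>Basis. (?F p \<bullet> i) *\<^sub>R i)"
      by (rule euclidean_representation[symmetric])
    also have "\<dots> = (\<Sum>i\<in>Basis. h i p *\<^sub>R i)"
      using elim by (intro sum.cong) auto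
    finally show ?case by (auto simp: mem_Times_iff)
  qed
  moreover have "(\<lambda>p. \<Sum>i\<in>Basis. h i p *\<^sub>R i) \<in> borel_measurable borel"
    using h(1) by (intro borel_measurable_sum borel_measurable_scaleR) auto
  ultimately show ?thesis by (rule bexI)
qed

lemma AE_lborel_sections:
  assumes "AE p in (lborel :: (real \<times> 'a::euclidean_space) measure). P p"
  shows "AE t in lborel. AE x in lborel. P (t, x)"
proof (rule lborel_pair.AE_pair)
  show "AE p in lborel \<Otimes>\<^sub>M lborel. P p"
    using assms unfolding lborel_prod .
qed

lemma borel_section:
  assumes "A \<in> sets (borel :: ('a::euclidean_space \<times> 'b::euclidean_space) measure)"
  shows "{y. (t, y) \<in> A} \<in> sets borel"
proof -
  have "(\<lambda>y. (t, y)) \<in> borel_measurable borel"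
    by (intro borel_measurable_continuous_onI continuous_intros)
  from measurable_sets[OF this assms] show ?thesis by (simp add: vimage_def)
qed

lemma measurable_section_emeasure:
  assumes "A \<in> sets (borel :: (real \<times> 'a::euclidean_space) measure)"
  shows "(\<lambda>t. emeasure lborel {x. (t, x) \<in> A}) \<in> borel_measurable borel"
proof -
  have "A \<in> sets (lborel \<Otimes>\<^sub>M (lborel :: 'a measure))"
    using assms unfolding lborel_prod by simp
  from lborel_pair.measurable_emeasure_Pair1[OF this] show ?thesis
    by (simp add: vimage_def)
qed

text \<open>Off the set \<open>W\<close>, the value \<open>F (t, x)\<close> lies in the essential range of the section \<open>F (t, \<cdot>)\<close>:
  every neighbourhood of it is hit on a set of positive measure. A countable basis of the target makes
  \<open>W\<close> a countable union, which gives both that its sections are null and that it is jointly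
  measurable.\<close>

lemma essential_points_measurable:
  fixes F :: "real \<times> 'a::euclidean_space \<Rightarrow> 'b::second_countable_topology"
  assumes F: "F \<in> borel_measurable borel"
  shows "\<exists>W\<in>sets borel. (\<forall>t. AE x in lborel. (t, x) \<notin> W) \<and>
           (\<forall>t x U. (t, x) \<notin> W \<longrightarrow> open U \<longrightarrow> F (t, x) \<in> U \<longrightarrow>
              emeasure lborel {y. F (t, y) \<in> U} \<noteq> 0)"
proof -
  obtain \<B> :: "'b set set" where \<B>: "countable \<B>" "topological_basis \<B>"
    using ex_countable_basis by blast
  define W where "W = (\<Union>U\<in>\<B>. {p. F p \<in> U \<and> emeasure lborel {y. F (fst p, y) \<in> U} = 0})"
  have pre: "F -` U \<in> sets borel" if "U \<in> \<B>" for U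
    using measurable_sets[OF F, of U] topological_basis_open[OF \<B>(2) that] by simp
  have "{p. F p \<in> U \<and> emeasure lborel {y. F (fst p, y) \<in> U} = 0} \<in> sets borel" if "U \<in> \<B>" for U
  proof -
    have "(\<lambda>p :: real \<times> 'a. emeasure lborel {y. F (fst p, y) \<in> U}) \<in> borel_measurable borel"
      by (rule measurable_compose[OF _ measurable_section_emeasure[OF pre[OF that], simplified]])
        (simp add: borel_prod[symmetric])
    from measurable_sets[OF this, of "{0}"] pre[OF that]
    have "F -` U \<inter> (\<lambda>p. emeasure lborel {y. F (fst p, y) \<in> U}) -` {0} \<in> sets borel"
      by auto
    then show ?thesis by (simp add: vimage_def Int_def)
  qed
  then have "W \<in> sets borel"
    unfolding W_def by (intro sets.countable_UN' \<B>(1)) auto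
  moreover have "AE x in lborel. (t, x) \<notin> W" for t
  proof -
    have "AE x in lborel. \<forall>U\<in>\<B>. \<not> (F (t, x) \<in> U \<and> emeasure lborel {y. F (t, y) \<in> U} = 0)"
    proof (subst AE_ball_countable[OF \<B>(1)], intro ballI)
      fix U assume U: "U \<in> \<B>"
      show "AE x in lborel. \<not> (F (t, x) \<in> U \<and> emeasure lborel {y. F (t, y) \<in> U} = 0)"
      proof (cases "emeasure lborel {y. F (t, y) \<in> U} = 0")
        case True
        then have "{y. F (t, y) \<in> U} \<in> null_sets lborel"
          using borel_section[OF pre[OF U], of t] by (simp add: null_sets_def)
        from AE_not_in[OF this] show ?thesis by eventually_elim auto
      qed simp
    qed
    then show ?thesis by eventually_elim (auto simp: W_def)
  qed
  moreover have "emeasure lborel {y. F (t, y) \<in> U} \<noteq> 0"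
    if *: "(t, x) \<notin> W" "open U" "F (t, x) \<in> U" for t x U
  proof -
    obtain V where V: "V \<in> \<B>" "F (t, x) \<in> V" "V \<subseteq> U"
      using topological_basisE[OF \<B>(2) *(2,3)] by blast
    have "emeasure lborel {y. F (t, y) \<in> V} \<noteq> 0"
      using V *(1) by (auto simp: W_def)
    moreover have "{y. F (t, y) \<in> U} = {y. (t, y) \<in> F -` U}" by auto
    moreover have "F -` U \<in> sets borel"
      using measurable_sets[OF F, of U] *(2) by simp
    ultimately show ?thesis
      using V(3) emeasure_mono[of "{y. F (t, y) \<in> V}" "{y. F (t, y) \<in> U}" lborel] borel_section[of "F -` U" t]
      by (auto simp: subset_iff)
  qed
  ultimately show ?thesis by blast
qed

text \<open>The exceptional sets in \<open>condition_H\<close> are chosen separately for each time, so their union over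
  time need not be measurable. They can be replaced by the sections of one Borel set \<open>Z\<close>, of which
  almost all are null. To see this, apply the preceding lemma to \<open>F = (x, b, g)\<close>, with \<open>b\<close> and \<open>g\<close> in
  Borel versions: the inequality is a closed condition on \<open>(F (t, x), F (t, y))\<close>, it holds off null
  sets, and every neighbourhood of a point of the essential range contains values taken off those null
  sets. Including the whole slices over times at which the Borel versions differ from \<open>b\<close> and \<open>g\<close> on
  a set of positive measure lets the inequality hold at every time.\<close>

lemma condition_H_borel_exceptional_set:
  fixes b :: "real \<Rightarrow> 'a::euclidean_space \<Rightarrow> 'a"
  assumes \<rho>: "osgood_modulus \<rho>" and b: "spacetime_measurable T b" and H: "condition_H \<rho> T b g"
  obtains Z g' where "Z \<in> sets borel" "g' \<in> borel_measurable borel"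
    "AE t in lborel. AE x in lborel. (t, x) \<notin> Z"
    "\<And>t x. t \<in> {0..T} \<Longrightarrow> (t, x) \<notin> Z \<Longrightarrow> g' (t, x) = g t x"
    "\<And>t x y. t \<in> {0..T} \<Longrightarrow> (t, x) \<notin> Z \<Longrightarrow> (t, y) \<notin> Z \<Longrightarrow>
       norm (b t x - b t y) \<le> (g t x + g t y) * \<rho> (norm (x - y))"
proof -
  have g: "spacetime_measurable T g"
    using H by (simp add: condition_H_def in_L1_L1loc_def)
  obtain N where N: "\<And>t. t \<in> {0..T} \<Longrightarrow> negligible (N t)"
    "\<And>t x y. t \<in> {0..T} \<Longrightarrow> x \<notin> N t \<Longrightarrow> y \<notin> N t \<Longrightarrow>
             norm (b t x - b t y) \<le> (g t x + g t y) * \<rho> (norm (x - y))"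
  proof -
    obtain N where "\<forall>t\<in>{0..T}. negligible (N t)"
      and "\<forall>t\<in>{0..T}. \<forall>x y. x \<notin> N t \<longrightarrow> y \<notin> N t \<longrightarrow>
             norm (b t x - b t y) \<le> (g t x + g t y) * \<rho> (norm (x - y))"
      using H unfolding condition_H_def by (elim conjE exE)
    then show thesis by (intro that[of N]) simp_all
  qed
  obtain b' where b': "b' \<in> borel_measurable borel"
    "AE p in lborel. fst p \<in> {0..T} \<longrightarrow> b (fst p) (snd p) = b' p"
    using spacetime_borel_version[OF b] by blast
  obtain g' where g': "g' \<in> borel_measurable borel"
    "AE p in lborel. fst p \<in> {0..T} \<longrightarrow> g (fst p) (snd p) = g' p"
    using spacetime_borel_version[OF g] by blast
  have "AE p in lborel. fst p \<in> {0..T} \<longrightarrow> b (fst p) (snd p) = b' p \<and> g (fst p) (snd p) = g' p"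
    using b'(2) g'(2) by eventually_elim auto
  then obtain Z0 where Z0: "Z0 \<in> null_sets lborel"
    "\<And>p. p \<notin> Z0 \<Longrightarrow> fst p \<in> {0..T} \<Longrightarrow> b (fst p) (snd p) = b' p \<and> g (fst p) (snd p) = g' p"
    by (elim AE_E3) auto
  define F where "F = (\<lambda>p. (snd p, b' p, g' p))"
  have F: "F \<in> borel_measurable borel"
    unfolding F_def using b'(1) g'(1)
    by (auto intro!: borel_measurable_Pair simp: borel_prod[symmetric])
  obtain W where W: "W \<in> sets borel" "\<And>t. AE x in lborel. (t, x) \<notin> W"
    "\<And>t x U. (t, x) \<notin> W \<Longrightarrow> open U \<Longrightarrow> F (t, x) \<in> U \<Longrightarrow> emeasure lborel {y. F (t, y) \<in> U} \<noteq> 0"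
    using essential_points_measurable[OF F] by blast
  define B where "B = {p :: real \<times> 'a. emeasure lborel {x. (fst p, x) \<in> Z0} \<noteq> 0}"
  have Z0b: "Z0 \<in> sets borel" using Z0(1) by auto
  have "(\<lambda>p :: real \<times> 'a. emeasure lborel {x. (fst p, x) \<in> Z0}) \<in> borel_measurable borel"
    by (rule measurable_compose[OF _ measurable_section_emeasure[OF Z0b]])
      (simp add: borel_prod[symmetric])
  from measurable_sets[OF this, of "- {0}"] have B: "B \<in> sets borel"
    by (simp add: B_def vimage_def)
  have sec: "{y. (t, y) \<in> Z0} \<in> sets borel" for t
    by (rule borel_section[OF Z0b])
  have Z0sec: "AE t in lborel. AE x in lborel. (t, x) \<notin> Z0"
    using AE_not_in[OF Z0(1)] by (rule AE_lborel_sections)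
  define Z where "Z = Z0 \<union> W \<union> B"
  show thesis
  proof (rule that)
    show "Z \<in> sets borel" using Z0b W(1) B by (auto simp: Z_def)
    show "g' \<in> borel_measurable borel" by fact
    show "AE t in lborel. AE x in lborel. (t, x) \<notin> Z"
      using Z0sec
    proof eventually_elim
      case (elim t)
      then have "emeasure lborel {x. (t, x) \<in> Z0} = 0"
        using sec[of t] by (simp add: AE_iff_measurable[OF _ refl])
      then show ?case
        using elim W(2)[of t] by (auto simp: Z_def B_def)
    qed
    show "g' (t, x) = g t x" if "t \<in> {0..T}" "(t, x) \<notin> Z" for t x
      using Z0(2)[of "(t, x)"] that by (auto simp: Z_def)
    fix t x y assume t: "t \<in> {0..T}" and xy: "(t, x) \<notin> Z" "(t, y) \<notin> Z"
    \<comment> \<open>The inequality at the points \<open>x\<close> and \<open>y\<close> says that \<open>\<Phi>\<close> is nonnegative at \<open>(F (t, x), F (t, y))\<close>.\<close>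
    define \<Phi> :: "('a \<times> 'a \<times> real) \<times> ('a \<times> 'a \<times> real) \<Rightarrow> real" where
      "\<Phi> = (\<lambda>(p, q). (snd (snd p) + snd (snd q)) * \<rho> (norm (fst p - fst q))
                     - norm (fst (snd p) - fst (snd q)))"
    have \<Phi>: "continuous_on UNIV \<Phi>"
    proof -
      have "continuous_on UNIV (\<lambda>r :: ('a \<times> 'a \<times> real) \<times> ('a \<times> 'a \<times> real).
              \<rho> (norm (fst (fst r) - fst (snd r))))"
      proof (rule continuous_on_compose2[of "{0..}" \<rho>])
        show "continuous_on {0..} \<rho>" using \<rho> by (simp add: osgood_modulus_def)
      qed (auto intro!: continuous_intros)
      then show ?thesis
        unfolding \<Phi>_def case_prod_beta' by (intro continuous_intros)
    qed
    have eq: "b t z = b' (t, z)" "g t z = g' (t, z)" if "(t, z) \<notin> Z0" for z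
      using Z0(2)[of "(t, z)"] that t by auto
    have \<Phi>F: "\<Phi> (F (t, z), F (t, z')) = (g t z + g t z') * \<rho> (norm (z - z')) - norm (b t z - b t z')"
      if "(t, z) \<notin> Z0" "(t, z') \<notin> Z0" for z z'
      using eq[OF that(1)] eq[OF that(2)] by (simp add: \<Phi>_def F_def)
    have null: "AE z in lborel. z \<notin> N t \<and> (t, z) \<notin> Z0"
    proof -
      have "AE z in lebesgue. z \<notin> N t"
        using N(1)[OF t] by (auto simp: negligible_iff_null_sets dest: AE_not_in)
      then have 1: "AE z in lborel. z \<notin> N t" by (simp add: AE_completion_iff)
      have "{z. (t, z) \<in> Z0} \<in> null_sets lborel"
        using xy(1) sec[of t] by (auto simp: Z_def B_def null_sets_def)
      from AE_not_in[OF this] 1 show ?thesis by eventually_elim auto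
    qed
    have near: "\<exists>z'. z' \<notin> N t \<and> (t, z') \<notin> Z0 \<and> F (t, z') \<in> U"
      if z: "(t, z) \<notin> Z" and U: "open U" "F (t, z) \<in> U" for z U
    proof (rule ccontr)
      assume none: "\<not> ?thesis"
      have "AE z' in lborel. z' \<notin> {y. F (t, y) \<in> U}"
        using null by (rule eventually_mono) (use none in blast)
      moreover have "{y. F (t, y) \<in> U} \<in> sets borel"
      proof -
        have "(\<lambda>y :: 'a. F (t, y)) \<in> borel_measurable borel"
          by (rule measurable_compose[OF _ F])
            (intro borel_measurable_continuous_onI continuous_intros)
        from measurable_sets[OF this, of U] U(1) show ?thesis by (simp add: vimage_def)
      qed
      ultimately have "emeasure lborel {y. F (t, y) \<in> U} = 0"
        by (simp add: AE_iff_measurable[OF _ refl])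
      then show False using W(3)[of t z U] z U by (auto simp: Z_def)
    qed
    show "norm (b t x - b t y) \<le> (g t x + g t y) * \<rho> (norm (x - y))"
    proof (rule ccontr)
      assume "\<not> ?thesis"
      then have "\<Phi> (F (t, x), F (t, y)) < 0"
        using \<Phi>F[of x y] xy by (auto simp: Z_def)
      moreover have "open {p. \<Phi> p < 0}"
        using \<Phi> by (intro open_Collect_less) auto
      ultimately obtain A A' where A: "open A" "open A'" "F (t, x) \<in> A" "F (t, y) \<in> A'"
          "A \<times> A' \<subseteq> {p. \<Phi> p < 0}"
        by (elim open_prod_elim[where x = "(F (t, x), F (t, y))"]) auto
      obtain x' where x': "x' \<notin> N t" "(t, x') \<notin> Z0" "F (t, x') \<in> A"
        using near[OF xy(1) A(1,3)] by blast
      obtain y' where y': "y' \<notin> N t" "(t, y') \<notin> Z0" "F (t, y') \<in> A'"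
        using near[OF xy(2) A(2,4)] by blast
      have "\<Phi> (F (t, x'), F (t, y')) < 0" using A(5) x' y' by auto
      then show False using \<Phi>F[of x' y'] N(2)[OF t, of x' y'] x' y' by simp
    qed
  qed
qed

section \<open>Flows with bounded compression\<close>

lemma sigma_finite_lebesgue: "sigma_finite_measure (lebesgue :: 'a::euclidean_space measure)"
proof
  obtain A :: "'a set set" where A: "countable A" "A \<subseteq> sets lborel" "\<Union>A = space lborel"
      "\<forall>a\<in>A. emeasure lborel a \<noteq> \<infinity>"
    using lborel.sigma_finite_countable by auto
  have "\<forall>a\<in>A. emeasure lebesgue a \<noteq> \<infinity>"
    using A(2,4) by (auto simp: subset_iff)
  then show "\<exists>A. countable A \<and> A \<subseteq> sets lebesgue \<and> \<Union>A = space lebesgue \<and>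
      (\<forall>a\<in>A. emeasure (lebesgue :: 'a measure) a \<noteq> \<infinity>)"
    using A by (intro exI[of _ A]) (auto intro: sets_completionI_sets)
qed

interpretation lborel_lebesgue: pair_sigma_finite "lborel :: real measure"
    "lebesgue :: 'a::euclidean_space measure"
  unfolding pair_sigma_finite_def
  using sigma_finite_lebesgue sigma_finite_lborel by auto

text \<open>Functions continuous in time and measurable in space are jointly measurable: round the time down
  to a multiple of \<open>1 / (n + 1)\<close> and let \<open>n\<close> tend to infinity.\<close>

lemma borel_measurable_caratheodory:
  fixes Y :: "real \<Rightarrow> 'a \<Rightarrow> 'b::metric_space"
  assumes Y: "\<And>t. Y t \<in> borel_measurable M"
    and cont: "\<And>x. x \<in> space M \<Longrightarrow> continuous_on UNIV (\<lambda>t. Y t x)"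
  shows "(\<lambda>p. Y (fst p) (snd p)) \<in> borel_measurable (lborel \<Otimes>\<^sub>M M)"
proof (rule borel_measurable_LIMSEQ_metric)
  let ?\<tau> = "\<lambda>n t. real_of_int \<lfloor>real (Suc n) * t\<rfloor> / real (Suc n)"
  show "(\<lambda>p. Y (?\<tau> n (fst p)) (snd p)) \<in> borel_measurable (lborel \<Otimes>\<^sub>M M)" for n
  proof (rule measurable_compose_countable[where f = "\<lambda>i p. Y (real_of_int i / real (Suc n)) (snd p)"
        and g = "\<lambda>p. \<lfloor>real (Suc n) * fst p\<rfloor>"])
    show "(\<lambda>p. Y (real_of_int i / real (Suc n)) (snd p)) \<in> borel_measurable (lborel \<Otimes>\<^sub>M M)" for i
      by (rule measurable_compose[OF measurable_snd Y])
    show "(\<lambda>p. \<lfloor>real (Suc n) * fst p\<rfloor>) \<in> lborel \<Otimes>\<^sub>M M \<rightarrow>\<^sub>M count_space UNIV"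
      by measurable
  qed
  fix p :: "real \<times> 'a" assume "p \<in> space (lborel \<Otimes>\<^sub>M M)"
  then have "snd p \<in> space M" by (auto simp: space_pair_measure)
  then have isC: "isCont (\<lambda>t. Y t (snd p)) (fst p)"
    using cont by (simp add: continuous_on_eq_continuous_at)
  have lim: "(\<lambda>n. ?\<tau> n (fst p)) \<longlonglongrightarrow> fst p"
  proof (rule LIMSEQ_I)
    fix e :: real assume "e > 0"
    then obtain N where N: "inverse (real (Suc N)) < e"
      using reals_Archimedean by blast
    have "norm (?\<tau> n (fst p) - fst p) < e" if n: "n \<ge> N" for n
    proof -
      have "?\<tau> n (fst p) - fst p = - frac (real (Suc n) * fst p) / real (Suc n)"
        by (simp add: frac_def field_simps)
      then have "norm (?\<tau> n (fst p) - fst p) = frac (real (Suc n) * fst p) / real (Suc n)"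
        by (simp add: abs_mult frac_ge_0 del: of_nat_Suc)
      also have "\<dots> \<le> 1 / real (Suc n)"
        by (intro divide_right_mono) (auto simp: less_imp_le[OF frac_lt_1] simp del: of_nat_Suc)
      also have "\<dots> \<le> 1 / real (Suc N)"
        using n by (intro divide_left_mono) auto
      also have "\<dots> < e" using N by (simp add: inverse_eq_divide)
      finally show ?thesis .
    qed
    then show "\<exists>N. \<forall>n\<ge>N. norm (?\<tau> n (fst p) - fst p) < e" by blast
  qed
  show "(\<lambda>n. Y (?\<tau> n (fst p)) (snd p)) \<longlonglongrightarrow> Y (fst p) (snd p)"
    using isCont_tendsto_compose[OF isC lim] .
qed

lemma absolutely_continuous_fun_imp_continuous_on:
  assumes f: "absolutely_continuous_fun a b f"
  shows "continuous_on {a..b} f"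
  unfolding continuous_on_iff
proof (intro ballI allI impI)
  fix x and e :: real assume x: "x \<in> {a..b}" and "e > 0"
  then obtain d where d: "d > 0" and I: "\<And>I :: (real \<times> real) set.
        finite I \<and> (\<forall>(u, v)\<in>I. a \<le> u \<and> u \<le> v \<and> v \<le> b) \<and>
        pairwise (\<lambda>(u, v) (u', v'). {u<..<v} \<inter> {u'<..<v'} = {}) I \<and>
        (\<Sum>(u, v)\<in>I. v - u) < d \<Longrightarrow> (\<Sum>(u, v)\<in>I. norm (f v - f u)) < e"
    using f unfolding absolutely_continuous_fun_def by blast
  \<comment> \<open>A single interval suffices.\<close>
  have "dist (f y) (f x) < e" if y: "y \<in> {a..b}" "dist y x < d" for y
    using I[of "{(min x y, max x y)}"] x y
    by (auto simp: dist_real_def dist_norm min_def max_def norm_minus_commute abs_if split: if_splits)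
  then show "\<exists>d>0. \<forall>y\<in>{a..b}. dist y x < d \<longrightarrow> dist (f y) (f x) < e"
    using d by blast
qed

text \<open>Only \<open>X t\<close> for each fixed \<open>t\<close> is known to be measurable. Changing the flow on the null set \<open>N\<close> of
  points with a bad trajectory gives a jointly measurable version \<open>Y\<close> with the same compression
  bound.\<close>

lemma regular_lagrangian_flow_version:
  fixes X :: "real \<Rightarrow> 'a::euclidean_space \<Rightarrow> 'a"
  assumes X: "regular_lagrangian_flow T b X" and T: "0 \<le> T"
  obtains N Y L where "N \<in> null_sets lebesgue"
    "(\<lambda>p. Y (fst p) (snd p)) \<in> borel_measurable (lborel \<Otimes>\<^sub>M lebesgue)"
    "\<And>t x. t \<in> {0..T} \<Longrightarrow> x \<notin> N \<Longrightarrow> Y t x = X t x"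
    "\<And>x. x \<notin> N \<Longrightarrow> set_integrable lebesgue {0..T} (\<lambda>s. b s (X s x))"
    "\<And>t x. t \<in> {0..T} \<Longrightarrow> x \<notin> N \<Longrightarrow> X t x = x + (LINT s:{0..t}|lebesgue. b s (X s x))"
    "L > 0"
    "\<forall>t\<in>{0..T}. \<forall>A\<in>sets borel.
       emeasure (distr lebesgue borel (Y t)) A \<le> ennreal L * emeasure lborel A"
proof -
  have XM: "X t \<in> borel_measurable lebesgue" if "t \<in> {0..T}" for t
    using X that by (auto simp: regular_lagrangian_flow_def)
  obtain L where L: "L > 0" "\<And>t A. t \<in> {0..T} \<Longrightarrow> A \<in> sets borel \<Longrightarrow>
       emeasure (distr lebesgue borel (X t)) A \<le> ennreal L * emeasure lborel A"
    using X unfolding regular_lagrangian_flow_def by (elim conjE exE) auto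
  have "AE x in lebesgue. absolutely_continuous_fun 0 T (\<lambda>t. X t x) \<and>
        set_integrable lebesgue {0..T} (\<lambda>s. b s (X s x)) \<and>
        (\<forall>t\<in>{0..T}. X t x = x + (LINT s:{0..t}|lebesgue. b s (X s x)))"
    using X by (simp add: regular_lagrangian_flow_def)
  then obtain N where N: "N \<in> null_sets lebesgue" and good: "\<And>x. x \<notin> N \<Longrightarrow>
        absolutely_continuous_fun 0 T (\<lambda>t. X t x) \<and>
        set_integrable lebesgue {0..T} (\<lambda>s. b s (X s x)) \<and>
        (\<forall>t\<in>{0..T}. X t x = x + (LINT s:{0..t}|lebesgue. b s (X s x)))"
    by (elim AE_E3) auto
  \<comment> \<open>Time is clamped to the interval so that \<open>Y\<close> is continuous on the whole line; the value on the
     null set \<open>N\<close> is arbitrary.\<close>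
  define Y where "Y t x = (if x \<in> N then 0 else X (max 0 (min T t)) x)" for t x
  have YM: "Y t \<in> borel_measurable lebesgue" for t
    unfolding Y_def using XM[of "max 0 (min T t)"] N T
    by (intro measurable_If_set) auto
  have YX: "Y t x = X t x" if "t \<in> {0..T}" "x \<notin> N" for t x
    using that by (simp add: Y_def)
  have cont: "continuous_on UNIV (\<lambda>t. Y t x)" for x
  proof (cases "x \<in> N")
    case False
    have "continuous_on {0..T} (\<lambda>t. X t x)"
      using good[OF False] by (intro absolutely_continuous_fun_imp_continuous_on) auto
    then have "continuous_on UNIV (\<lambda>t. X (max 0 (min T t)) x)"
      by (rule continuous_on_compose2) (use T in \<open>auto intro!: continuous_intros\<close>)
    then show ?thesis using False by (simp add: Y_def)
  qed (simp add: Y_def)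
  show thesis
  proof (rule that[of N Y L])
    show "(\<lambda>p. Y (fst p) (snd p)) \<in> borel_measurable (lborel \<Otimes>\<^sub>M lebesgue)"
      by (rule borel_measurable_caratheodory[OF YM cont])
    show "\<forall>t\<in>{0..T}. \<forall>A\<in>sets borel.
        emeasure (distr lebesgue borel (Y t)) A \<le> ennreal L * emeasure lborel A"
    proof (intro ballI)
      fix t and A :: "'a set" assume t: "t \<in> {0..T}" and A: "A \<in> sets borel"
      have "AE x in lebesgue. Y t x = X t x"
        using AE_not_in[OF N] by eventually_elim (use YX[OF t] in auto)
      then have "distr lebesgue borel (Y t) = distr lebesgue borel (X t)"
        using YM XM[OF t] by (intro distr_cong_AE) auto
      then show "emeasure (distr lebesgue borel (Y t)) A \<le> ennreal L * emeasure lborel A"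
        using L(2)[OF t A] by simp
    qed
  qed (use N YX good L(1) in auto)
qed

text \<open>By the compression bound and Fubini's theorem, almost every trajectory spends zero time in a
  Borel set of spacetime with null sections.\<close>

lemma compressible_flow_avoids_null_sets:
  fixes Y :: "real \<Rightarrow> 'a::euclidean_space \<Rightarrow> 'a"
  assumes Y: "(\<lambda>p. Y (fst p) (snd p)) \<in> borel_measurable (lborel \<Otimes>\<^sub>M lebesgue)"
    and comp: "\<forall>t\<in>{0..T}. \<forall>A\<in>sets borel.
       emeasure (distr lebesgue borel (Y t)) A \<le> ennreal L * emeasure lborel A"
    and Z: "Z \<in> sets borel" "AE t in lborel. AE y in lborel. (t, y) \<notin> Z"
  shows "AE x in lebesgue. AE t in lborel. t \<in> {0..T} \<longrightarrow> (t, Y t x) \<notin> Z"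
proof -
  let ?M = "(lborel :: real measure) \<Otimes>\<^sub>M (lebesgue :: 'a measure)"
  have YM: "Y t \<in> borel_measurable lebesgue" for t
    using measurable_Pair2[OF Y, of t] by simp
  have \<Psi>: "(\<lambda>p. (fst p, Y (fst p) (snd p))) \<in> borel_measurable ?M"
    by (intro borel_measurable_Pair Y) measurable
  have "AE t in lborel. AE x in lebesgue. t \<in> {0..T} \<longrightarrow> (t, Y t x) \<notin> Z"
    using Z(2)
  proof eventually_elim
    case (elim t)
    let ?Zt = "{y. (t, y) \<in> Z}"
    have m: "?Zt \<in> sets borel" by (rule borel_section[OF Z(1)])
    have "emeasure lborel ?Zt = 0"
      using elim m by (simp add: AE_iff_measurable[OF _ refl])
    then have "emeasure (distr lebesgue borel (Y t)) ?Zt = 0" if "t \<in> {0..T}"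
      using bspec[OF bspec[OF comp that] m] by simp
    then have "Y t -` ?Zt \<in> null_sets lebesgue" if "t \<in> {0..T}"
      using that measurable_sets[OF YM m, of t] by (simp add: null_sets_def emeasure_distr[OF YM m])
    then show ?case by (cases "t \<in> {0..T}") (auto dest: AE_not_in)
  qed
  moreover have "{p \<in> space ?M. fst p \<in> {0..T} \<longrightarrow> (fst p, Y (fst p) (snd p)) \<notin> Z} \<in> sets ?M"
  proof -
    have "(\<lambda>p. (fst p, Y (fst p) (snd p))) -` Z \<inter> space ?M \<in> sets ?M"
      by (rule measurable_sets[OF \<Psi> Z(1)])
    moreover have "fst -` {0..T} \<inter> space ?M \<in> sets ?M"
      by (rule measurable_sets[OF measurable_fst]) simp
    ultimately have "space ?M - (((\<lambda>p. (fst p, Y (fst p) (snd p))) -` Z \<inter> space ?M) \<inter>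
        (fst -` {0..T} \<inter> space ?M)) \<in> sets ?M"
      by (rule sets.compl_sets[OF sets.Int])
    also have "space ?M - (((\<lambda>p. (fst p, Y (fst p) (snd p))) -` Z \<inter> space ?M) \<inter>
        (fst -` {0..T} \<inter> space ?M)) =
        {p \<in> space ?M. fst p \<in> {0..T} \<longrightarrow> (fst p, Y (fst p) (snd p)) \<notin> Z}" by auto
    finally show ?thesis .
  qed
  ultimately show ?thesis
    by (subst lborel_lebesgue.AE_commute[symmetric])
qed

text \<open>The same argument bounds the average of \<open>f\<close> along trajectories by the spacetime integral of \<open>f\<close>.\<close>

lemma compressible_flow_integral:
  fixes Y :: "real \<Rightarrow> 'a::euclidean_space \<Rightarrow> 'a" and f :: "real \<times> 'a \<Rightarrow> ennreal"
  assumes Y: "(\<lambda>p. Y (fst p) (snd p)) \<in> borel_measurable (lborel \<Otimes>\<^sub>M lebesgue)"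
    and comp: "\<forall>t\<in>{0..T}. \<forall>A\<in>sets borel.
       emeasure (distr lebesgue borel (Y t)) A \<le> ennreal L * emeasure lborel A"
    and f: "f \<in> borel_measurable borel"
  shows "(\<lambda>x. \<integral>\<^sup>+t\<in>{0..T}. f (t, Y t x) \<partial>lborel) \<in> borel_measurable lebesgue"
    and "(\<integral>\<^sup>+x. (\<integral>\<^sup>+t\<in>{0..T}. f (t, Y t x) \<partial>lborel) \<partial>lebesgue)
           \<le> ennreal L * (\<integral>\<^sup>+t\<in>{0..T}. (\<integral>\<^sup>+y. f (t, y) \<partial>lborel) \<partial>lborel)"
proof -
  let ?M = "(lborel :: real measure) \<Otimes>\<^sub>M (lebesgue :: 'a measure)"
  have YM: "Y t \<in> borel_measurable lebesgue" for t
    using measurable_Pair2[OF Y, of t] by simp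
  have \<Psi>: "(\<lambda>p. (fst p, Y (fst p) (snd p))) \<in> borel_measurable ?M"
    by (intro borel_measurable_Pair Y) measurable
  have ind: "(\<lambda>p. indicator {0..T} (fst p) :: ennreal) \<in> borel_measurable ?M"
    by (rule measurable_compose[OF measurable_fst]) simp
  have meas: "(\<lambda>(t, x). f (t, Y t x) * indicator {0..T} t) \<in> borel_measurable ?M"
    using measurable_compose[OF \<Psi> f] ind by (simp add: case_prod_beta')
  show "(\<lambda>x. \<integral>\<^sup>+t\<in>{0..T}. f (t, Y t x) \<partial>lborel) \<in> borel_measurable lebesgue"
    using measurable_pair_swap[OF meas]
    by (intro lborel.borel_measurable_nn_integral) (simp add: case_prod_beta')
  have "(\<integral>\<^sup>+x. (\<integral>\<^sup>+t\<in>{0..T}. f (t, Y t x) \<partial>lborel) \<partial>lebesgue) =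
        (\<integral>\<^sup>+t. (\<integral>\<^sup>+x. f (t, Y t x) * indicator {0..T} t \<partial>lebesgue) \<partial>lborel)"
    by (rule lborel_lebesgue.Fubini'[OF meas])
  also have "\<dots> \<le> (\<integral>\<^sup>+t. ennreal L * ((\<integral>\<^sup>+y. f (t, y) \<partial>lborel) * indicator {0..T} t) \<partial>lborel)"
  proof (rule nn_integral_mono)
    fix t
    have ft: "(\<lambda>y. f (t, y)) \<in> borel_measurable borel"
      by (rule measurable_compose[OF _ f]) (intro borel_measurable_continuous_onI continuous_intros)
    show "(\<integral>\<^sup>+x. f (t, Y t x) * indicator {0..T} t \<partial>lebesgue)
            \<le> ennreal L * ((\<integral>\<^sup>+y. f (t, y) \<partial>lborel) * indicator {0..T} t)"
    proof (cases "t \<in> {0..T}")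
      case True
      have "distr lebesgue borel (Y t) \<le> scale_measure (ennreal L) lborel"
        using bspec[OF comp True] by (subst le_measure) auto
      then have "(\<integral>\<^sup>+y. f (t, y) \<partial>distr lebesgue borel (Y t)) \<le>
          (\<integral>\<^sup>+y. f (t, y) \<partial>scale_measure (ennreal L) lborel)"
        by (intro nn_integral_mono_measure) auto
      then show ?thesis
        using True ft by (simp add: nn_integral_distr[OF YM] nn_integral_scale_measure)
    qed simp
  qed
  also have "\<dots> = ennreal L * (\<integral>\<^sup>+t\<in>{0..T}. (\<integral>\<^sup>+y. f (t, y) \<partial>lborel) \<partial>lborel)"
  proof (rule nn_integral_cmult)
    have "(\<lambda>t. \<integral>\<^sup>+y. f (t, y) \<partial>lborel) \<in> borel_measurable lborel"
    proof (rule lborel.borel_measurable_nn_integral)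
      have "f \<in> borel_measurable (borel \<Otimes>\<^sub>M borel)"
        using f by (simp add: borel_prod)
      then show "(\<lambda>(t, y). f (t, y)) \<in> borel_measurable (lborel \<Otimes>\<^sub>M lborel)"
        by (simp add: case_prod_beta' cong: measurable_cong_sets)
    qed
    then show "(\<lambda>t. (\<integral>\<^sup>+y. f (t, y) \<partial>lborel) * indicator {0..T} t) \<in> borel_measurable lborel"
      by simp
  qed
  finally show "(\<integral>\<^sup>+x. (\<integral>\<^sup>+t\<in>{0..T}. f (t, Y t x) \<partial>lborel) \<partial>lebesgue)
           \<le> ennreal L * (\<integral>\<^sup>+t\<in>{0..T}. (\<integral>\<^sup>+y. f (t, y) \<partial>lborel) \<partial>lborel)" .
qed

section \<open>The quantitative stability estimate\<close>

lemma set_integrable_of_nn_integral_le: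
  fixes k :: "real \<Rightarrow> real"
  assumes k: "k \<in> borel_measurable borel" "\<And>t. 0 \<le> k t"
    and le: "(\<integral>\<^sup>+t\<in>{0..T}. ennreal (k t) \<partial>lborel) \<le> ennreal c" and c: "0 \<le> c"
  shows "set_integrable lebesgue {0..T} k" and "(LINT t:{0..T}|lebesgue. k t) \<le> c"
proof -
  let ?k = "\<lambda>t. indicator {0..T} t *\<^sub>R k t"
  have nn: "(\<integral>\<^sup>+t. ennreal (?k t) \<partial>lebesgue) \<le> ennreal c"
  proof -
    have "(\<integral>\<^sup>+t. ennreal (?k t) \<partial>lebesgue) = (\<integral>\<^sup>+t\<in>{0..T}. ennreal (k t) \<partial>lborel)"
      unfolding nn_integral_completion by (intro nn_integral_cong) (auto split: split_indicator)
    with le show ?thesis by simp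
  qed
  have m: "?k \<in> borel_measurable lborel"
    using k by simp
  have "integrable lebesgue ?k"
    unfolding integrable_iff_bounded
  proof
    show "?k \<in> borel_measurable lebesgue" using m by (rule measurable_completion)
    show "(\<integral>\<^sup>+t. ennreal (norm (?k t)) \<partial>lebesgue) < \<infinity>"
      using nn k(2) by (simp add: order.strict_trans1[OF _ ennreal_less_top])
  qed
  then show "set_integrable lebesgue {0..T} k" by (simp add: set_integrable_def)
  have "ennreal (LINT t|lebesgue. ?k t) = (\<integral>\<^sup>+t. ennreal (?k t) \<partial>lebesgue)"
    using k(2) by (intro nn_integral_eq_integral[symmetric] \<open>integrable lebesgue ?k\<close>) auto
  then show "(LINT t:{0..T}|lebesgue. k t) \<le> c"
    using nn c unfolding set_lebesgue_integral_def by (metis ennreal_le_iff)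
qed

lemma integral_curve_in_cball:
  fixes \<xi> :: "real \<Rightarrow> 'a::euclidean_space"
  assumes int: "set_integrable lebesgue {0..T} (\<lambda>s. b s (\<xi> s))"
    and eq: "\<xi> t = x + (LINT s:{0..t}|lebesgue. b s (\<xi> s))"
    and t: "t \<in> {0..T}" and M: "\<forall>s\<in>{0..T}. \<forall>y. norm (b s y) \<le> M"
    and x: "x \<in> ball 0 R"
  shows "\<xi> t \<in> cball 0 (R + T * M)"
proof -
  have i: "set_integrable lebesgue {0..t} (\<lambda>s. b s (\<xi> s))"
    using int t by (auto intro: set_integrable_subset)
  have M0: "0 \<le> M" by (rule order_trans[OF norm_ge_zero[of "b t 0"]]) (use M t in blast)
  have "norm (LINT s:{0..t}|lebesgue. b s (\<xi> s)) \<le> (LINT s:{0..t}|lebesgue. norm (b s (\<xi> s)))"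
    by (rule set_integral_norm_bound[OF i])
  also have "\<dots> \<le> (LINT s:{0..t}|lebesgue. M)"
  proof (rule set_integral_mono)
    show "set_integrable lebesgue {0..t} (\<lambda>s. norm (b s (\<xi> s)))"
      by (rule set_integrable_norm[OF i])
    show "set_integrable lebesgue {0..t} (\<lambda>s. M)"
      unfolding set_integrable_def
      by (intro integrable_scaleR_left integrable_real_indicator) (auto simp: emeasure_lborel_Icc_eq)
  qed (use M t in auto)
  also have "\<dots> = t * M" using t by (simp add: set_lebesgue_integral_def measure_completion)
  also have "\<dots> \<le> T * M" using t M0 by (intro mult_right_mono) auto
  finally show ?thesis
    using eq x norm_triangle_ineq[of x "LINT s:{0..t}|lebesgue. b s (\<xi> s)"]
    by (simp)
qed

theorem theorem4p1:
  fixes T :: real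
    and \<rho> :: "real \<Rightarrow> real"
    and b :: "real \<Rightarrow> 'a::euclidean_space \<Rightarrow> 'a"
    and g :: "real \<Rightarrow> 'a \<Rightarrow> real"
    and D :: "real \<Rightarrow> 'a \<Rightarrow> real"
    and X :: "real \<Rightarrow> 'a \<Rightarrow> 'a"
  assumes "T > 0"
    and "osgood_modulus \<rho>"
    and "spacetime_measurable T b"
    and "bounded ((\<lambda>(t, x). b t x) ` ({0..T} \<times> UNIV))"
    and "condition_H \<rho> T b g"
    and "spacetime_measurable T D"
    and "AE t in lebesgue_on {0..T}. has_distributional_divergence (b t) (D t)"
    and "in_L1_Linf T (\<lambda>t x. max 0 (- D t x))"
    and "regular_lagrangian_flow T b X"
  shows "\<forall>R>0. \<exists>C>0. \<forall>\<^sub>F \<epsilon> in at_right 0.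
           \<exists>E \<in> sets lebesgue. E \<subseteq> ball 0 R \<and>
             emeasure lebesgue (ball 0 R - E) \<le> ennreal \<epsilon> \<and>
             (\<forall>t\<in>{0..T}. \<forall>x\<in>E. \<forall>y\<in>E.
                ereal (norm (X t x - X t y)) \<le> psi_inv \<rho> (norm (x - y)) (C / \<epsilon>))"
proof (intro allI impI)
  fix R :: real assume "R > 0"
  have T: "0 \<le> T" using assms(1) by simp
  note \<rho> = assms(2)
  obtain M where M: "\<forall>s\<in>{0..T}. \<forall>y. norm (b s y) \<le> M"
    using assms(4) unfolding bounded_iff by force
  obtain Z g' where Z: "Z \<in> sets borel" "g' \<in> borel_measurable borel"
    "AE t in lborel. AE x in lborel. (t, x) \<notin> Z"
    "\<And>t x. t \<in> {0..T} \<Longrightarrow> (t, x) \<notin> Z \<Longrightarrow> g' (t, x) = g t x"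
    "\<And>t x y. t \<in> {0..T} \<Longrightarrow> (t, x) \<notin> Z \<Longrightarrow> (t, y) \<notin> Z \<Longrightarrow>
       norm (b t x - b t y) \<le> (g t x + g t y) * \<rho> (norm (x - y))"
  proof (rule condition_H_borel_exceptional_set[OF \<rho> assms(3,5)], goal_cases)
    case 1
    show thesis by (rule 1(1)[OF 1(2-)])
  qed
  obtain N Y L where N: "N \<in> null_sets lebesgue"
    and Y: "(\<lambda>p. Y (fst p) (snd p)) \<in> borel_measurable (lborel \<Otimes>\<^sub>M lebesgue)"
    and YX: "\<And>t x. t \<in> {0..T} \<Longrightarrow> x \<notin> N \<Longrightarrow> Y t x = X t x"
    and Xint: "\<And>x. x \<notin> N \<Longrightarrow> set_integrable lebesgue {0..T} (\<lambda>s. b s (X s x))"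
    and Xeq: "\<And>t x. t \<in> {0..T} \<Longrightarrow> x \<notin> N \<Longrightarrow> X t x = x + (LINT s:{0..t}|lebesgue. b s (X s x))"
    and L: "L > 0" "\<forall>t\<in>{0..T}. \<forall>A\<in>sets borel.
       emeasure (distr lebesgue borel (Y t)) A \<le> ennreal L * emeasure lborel A"
  proof (rule regular_lagrangian_flow_version[OF assms(9) T], goal_cases)
    case 1
    show thesis by (rule 1(1)[OF 1(2-)])
  qed
  \<comment> \<open>Only off \<open>Z\<close> is \<open>g'\<close> known to be nonnegative.\<close>
  define k where "k p = max 0 (g' p)" for p
  have k: "k \<in> borel_measurable borel" unfolding k_def using Z(2) by simp
  have k0: "0 \<le> k p" for p by (simp add: k_def)
  have kg: "k (t, x) = g t x" if "t \<in> {0..T}" "(t, x) \<notin> Z" for t x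
    using Z(4)[OF that] assms(5) that by (simp add: k_def condition_H_def)
  obtain N' where N': "N' \<in> null_sets lebesgue"
    and offZ: "\<And>x. x \<notin> N' \<Longrightarrow> AE t in lborel. t \<in> {0..T} \<longrightarrow> (t, Y t x) \<notin> Z"
    using compressible_flow_avoids_null_sets[OF Y L(2) Z(1,3)] by (elim AE_E3) auto
  \<comment> \<open>Trajectories from the ball of radius \<open>R\<close> stay in \<open>B\<close>, on which \<open>g\<close> is integrable over spacetime.\<close>
  define B :: "'a set" where "B = cball 0 (R + T * M)"
  define f where "f p = ennreal (k p) * indicator B (snd p)" for p
  have f: "f \<in> borel_measurable borel"
  proof -
    have "(snd :: real \<times> 'a \<Rightarrow> 'a) \<in> borel_measurable borel"
      by (intro borel_measurable_continuous_onI continuous_intros)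
    then have "(\<lambda>p :: real \<times> 'a. indicator B (snd p) :: ennreal) \<in> borel_measurable borel"
      by (rule measurable_compose[OF _ borel_measurable_indicator]) (simp add: B_def)
    then show ?thesis unfolding f_def using k by simp
  qed
  define I where "I = (\<integral>\<^sup>+t\<in>{0..T}. (\<integral>\<^sup>+y. f (t, y) \<partial>lborel) \<partial>lborel)"
  have "I < \<infinity>"
  proof -
    have "I = (\<integral>\<^sup>+t\<in>{0..T}. (\<integral>\<^sup>+x\<in>B. ennreal \<bar>g t x\<bar> \<partial>lebesgue) \<partial>lebesgue)"
      unfolding I_def nn_integral_completion
    proof (rule nn_integral_cong_AE)
      show "AE t in lborel. (\<integral>\<^sup>+y. f (t, y) \<partial>lborel) * indicator {0..T} t =
              (\<integral>\<^sup>+x\<in>B. ennreal \<bar>g t x\<bar> \<partial>lborel) * indicator {0..T} t"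
        using Z(3)
      proof eventually_elim
        case (elim t)
        have "(\<integral>\<^sup>+y. f (t, y) \<partial>lborel) = (\<integral>\<^sup>+x\<in>B. ennreal \<bar>g t x\<bar> \<partial>lborel)" if t: "t \<in> {0..T}"
        proof (rule nn_integral_cong_AE)
          show "AE x in lborel. f (t, x) = ennreal \<bar>g t x\<bar> * indicator B x"
            using elim
          proof eventually_elim
            case (elim x)
            then show ?case
              using kg[OF t elim] k0[of "(t, x)"] by (simp add: f_def)
          qed
        qed
        then show ?case by (cases "t \<in> {0..T}") auto
      qed
    qed
    also have "\<dots> < \<infinity>"
      using assms(5) unfolding condition_H_def in_L1_L1loc_def by (auto simp: B_def)
    finally show ?thesis .
  qed
  then have "ennreal L * I < \<infinity>" by (simp add: ennreal_mult_less_top)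
  then obtain K0 where K0: "K0 \<ge> 0" "ennreal L * I = ennreal K0"
    by (cases "ennreal L * I") auto
  \<comment> \<open>Adding \<open>1\<close> makes \<open>K\<close> positive, as is needed to divide by it.\<close>
  define K where "K = K0 + 1"
  have K: "K > 0" "ennreal L * I \<le> ennreal K"
    using K0 by (auto simp: K_def intro: ennreal_leI)
  define \<Gamma> where "\<Gamma> x = (\<integral>\<^sup>+t\<in>{0..T}. ennreal (k (t, Y t x)) \<partial>lborel)" for x
  have \<Gamma>: "\<Gamma> \<in> borel_measurable lebesgue"
    unfolding \<Gamma>_def
    by (rule compressible_flow_integral(1)[OF Y L(2), of "\<lambda>p. ennreal (k p)"]) (use k in auto)
  define A where "A = ball 0 R - (N \<union> N')"
  have A: "A \<in> sets lebesgue" 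
    unfolding A_def using null_setsD2[OF N] null_setsD2[OF N'] by (intro sets.Diff sets.Un) auto
  have int\<Gamma>: "(\<integral>\<^sup>+x\<in>A. \<Gamma> x \<partial>lebesgue) \<le> ennreal K"
  proof -
    have "\<Gamma> x * indicator A x \<le> (\<integral>\<^sup>+t\<in>{0..T}. f (t, Y t x) \<partial>lborel)" for x
    proof (cases "x \<in> A")
      case True
      then have "x \<notin> N" "x \<in> ball 0 R" by (auto simp: A_def)
      have "Y t x \<in> B" if "t \<in> {0..T}" for t
        unfolding B_def YX[OF that \<open>x \<notin> N\<close>]
        by (rule integral_curve_in_cball[where b = b and \<xi> = "\<lambda>s. X s x",
              OF Xint[OF \<open>x \<notin> N\<close>] Xeq[OF that \<open>x \<notin> N\<close>] that M \<open>x \<in> ball 0 R\<close>])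
      then have "\<Gamma> x = (\<integral>\<^sup>+t\<in>{0..T}. f (t, Y t x) \<partial>lborel)"
        unfolding \<Gamma>_def by (intro nn_integral_cong) (auto simp: f_def split: split_indicator)
      then show ?thesis using True by simp
    qed simp
    then have "(\<integral>\<^sup>+x\<in>A. \<Gamma> x \<partial>lebesgue) \<le> (\<integral>\<^sup>+x. (\<integral>\<^sup>+t\<in>{0..T}. f (t, Y t x) \<partial>lborel) \<partial>lebesgue)"
      by (intro nn_integral_mono) auto
    also have "\<dots> \<le> ennreal L * I"
      unfolding I_def by (rule compressible_flow_integral(2)[OF Y L(2) f])
    finally show ?thesis using K(2) by simp
  qed
  \<comment> \<open>Each of the two trajectories contributes at most \<open>K / \<epsilon>\<close> and the initial distance at most \<open>1\<close>,
     which is at most \<open>1 / \<epsilon>\<close> when \<open>\<epsilon> < 1\<close>.\<close>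
  let ?C = "2 * K + 1"
  have main: "\<exists>E \<in> sets lebesgue. E \<subseteq> ball 0 R \<and>
             emeasure lebesgue (ball 0 R - E) \<le> ennreal \<epsilon> \<and>
             (\<forall>t\<in>{0..T}. \<forall>x\<in>E. \<forall>y\<in>E.
                ereal (norm (X t x - X t y)) \<le> psi_inv \<rho> (norm (x - y)) (?C / \<epsilon>))"
    if \<epsilon>: "0 < \<epsilon>" "\<epsilon> < 1" for \<epsilon>
  proof -
    define E where "E = {x \<in> A. \<Gamma> x \<le> ennreal (K / \<epsilon>)}"
    have E: "E \<in> sets lebesgue"
    proof -
      have "\<Gamma> -` {..ennreal (K / \<epsilon>)} \<inter> space lebesgue \<in> sets lebesgue"
        by (rule measurable_sets[OF \<Gamma>]) simp
      then have "A \<inter> (\<Gamma> -` {..ennreal (K / \<epsilon>)} \<inter> space lebesgue) \<in> sets lebesgue"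
        using A by (rule sets.Int[rotated])
      also have "A \<inter> (\<Gamma> -` {..ennreal (K / \<epsilon>)} \<inter> space lebesgue) = E"
        by (auto simp: E_def)
      finally show ?thesis .
    qed
    have small: "emeasure lebesgue (ball 0 R - E) \<le> ennreal \<epsilon>"
    proof -
      let ?Q = "{x \<in> A. 1 \<le> ennreal (\<epsilon> / K) * \<Gamma> x}"
      have meas: "(\<lambda>x. \<Gamma> x * indicator A x) \<in> borel_measurable lebesgue"
        using \<Gamma> A by simp
      have "1 \<le> ennreal (\<epsilon> / K) * \<Gamma> x" if "\<not> \<Gamma> x \<le> ennreal (K / \<epsilon>)" for x
      proof -
        have "1 = ennreal (\<epsilon> / K) * ennreal (K / \<epsilon>)"
          using \<epsilon> K(1) by (simp add: ennreal_mult'[symmetric])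
        also have "\<dots> \<le> ennreal (\<epsilon> / K) * \<Gamma> x"
          using that by (intro mult_left_mono) auto
        finally show ?thesis .
      qed
      then have "ball 0 R - E \<subseteq> ?Q \<union> (N \<union> N')"
        by (auto simp: A_def E_def)
      moreover have Q: "?Q \<in> sets lebesgue"
      proof -
        have "(\<lambda>x. ennreal (\<epsilon> / K) * \<Gamma> x) -` {1..} \<inter> space lebesgue \<in> sets lebesgue"
          by (rule measurable_sets[of _ _ borel]) (use \<Gamma> in auto)
        then have "A \<inter> ((\<lambda>x. ennreal (\<epsilon> / K) * \<Gamma> x) -` {1..} \<inter> space lebesgue) \<in> sets lebesgue"
          using A by (rule sets.Int[rotated])
        also have "A \<inter> ((\<lambda>x. ennreal (\<epsilon> / K) * \<Gamma> x) -` {1..} \<inter> space lebesgue) = ?Q"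
          by auto
        finally show ?thesis .
      qed
      ultimately have "emeasure lebesgue (ball 0 R - E) \<le> emeasure lebesgue (?Q \<union> (N \<union> N'))"
        using N N' by (intro emeasure_mono) auto
      also have "\<dots> = emeasure lebesgue ?Q"
        using Q N N' by (intro emeasure_Un_null_set null_sets.Un) auto
      also have "\<dots> \<le> ennreal (\<epsilon> / K) * (\<integral>\<^sup>+x\<in>A. \<Gamma> x \<partial>lebesgue)"
        by (rule nn_integral_Markov_inequality[OF meas A])
      also have "\<dots> \<le> ennreal (\<epsilon> / K) * ennreal K"
        by (intro mult_left_mono int\<Gamma>) simp
      also have "\<dots> = ennreal \<epsilon>"
        using \<epsilon> K(1) by (simp add: ennreal_mult'[symmetric])
      finally show ?thesis .
    qed
    have pair: "ereal (norm (X t x - X t y)) \<le> psi_inv \<rho> (norm (x - y)) (?C / \<epsilon>)"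
      if t: "t \<in> {0..T}" and xy: "x \<in> E" "y \<in> E" for t x y
    proof (cases "x = y")
      case True
      then show ?thesis by (simp add: psi_inv_def)
    next
      case False
      define r where "r = norm (x - y)"
      have r: "r > 0" using False by (simp add: r_def)
      have nN: "x \<notin> N" "y \<notin> N" "x \<notin> N'" "y \<notin> N'"
        using xy by (auto simp: E_def A_def)
      define h where "h z s = k (s, Y s z)" for z s
      have h0: "0 \<le> h z s" for z s by (simp add: h_def k0)
      have hint: "set_integrable lebesgue {0..T} (h z)" "(LINT s:{0..T}|lebesgue. h z s) \<le> K / \<epsilon>"
        if "z \<in> E" for z
      proof -
        have "(\<lambda>s. (s, Y s z)) \<in> borel_measurable lborel"
          using measurable_Pair1[OF Y, of z] by (intro borel_measurable_Pair) auto
        from measurable_compose[OF this k] have hm: "h z \<in> borel_measurable borel"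
          by (simp add: h_def[abs_def])
        have "(\<integral>\<^sup>+s\<in>{0..T}. ennreal (h z s) \<partial>lborel) \<le> ennreal (K / \<epsilon>)"
          using that by (simp add: E_def \<Gamma>_def h_def)
        note * = set_integrable_of_nn_integral_le[OF hm h0 this]
        show "set_integrable lebesgue {0..T} (h z)" "(LINT s:{0..T}|lebesgue. h z s) \<le> K / \<epsilon>"
          using * \<epsilon> K by auto
      qed
      define v where "v s = b s (X s x) - b s (X s y)" for s
      have "psi \<rho> r (norm (X t x - X t y)) \<le> psi \<rho> r (norm (x - y)) +
              (LINT s:{0..T}|lebesgue. h x s + h y s)"
      proof (rule psi_bihari[where u = "\<lambda>t. X t x - X t y" and v = v, OF \<rho> r _ _ _ _ _ t])
        show "set_integrable lebesgue {0..T} v"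
          unfolding v_def by (intro set_integral_diff Xint nN)
        show "set_integrable lebesgue {0..T} (\<lambda>s. h x s + h y s)"
          by (intro set_integral_add hint xy)
        show "0 \<le> h x s + h y s" for s
          using h0[of x s] h0[of y s] by simp
        fix s assume s: "s \<in> {0..T}"
        have "set_integrable lebesgue {0..s} (\<lambda>s. b s (X s z))" if "z \<notin> N" for z
          using Xint[OF that] s by (auto intro: set_integrable_subset)
        then have "(LINT s:{0..s}|lebesgue. v s) =
            (LINT s:{0..s}|lebesgue. b s (X s x)) - (LINT s:{0..s}|lebesgue. b s (X s y))"
          unfolding v_def using nN by (intro set_integral_diff) auto
        then show "X s x - X s y = x - y + (LINT s:{0..s}|lebesgue. v s)"
          using Xeq[OF s nN(1)] Xeq[OF s nN(2)] by simp
      next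
        have "AE s in lborel. s \<in> {0..T} \<longrightarrow> norm (v s) \<le> (h x s + h y s) * \<rho> (norm (X s x - X s y))"
          using offZ[OF nN(3)] offZ[OF nN(4)]
        proof eventually_elim
          case (elim s)
          show ?case
          proof
            assume s: "s \<in> {0..T}"
            have nZ: "(s, X s x) \<notin> Z" "(s, X s y) \<notin> Z"
              using elim s YX[OF s nN(1)] YX[OF s nN(2)] by auto
            show "norm (v s) \<le> (h x s + h y s) * \<rho> (norm (X s x - X s y))"
              using Z(5)[OF s nZ] kg[OF s nZ(1)] kg[OF s nZ(2)] YX[OF s nN(1)] YX[OF s nN(2)]
              by (simp add: v_def h_def)
          qed
        qed
        then show "AE s in lebesgue. s \<in> {0..T} \<longrightarrow>
            norm (v s) \<le> (h x s + h y s) * \<rho> (norm (X s x - X s y))"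
          by (simp add: AE_completion_iff)
      qed
      also have "(LINT s:{0..T}|lebesgue. h x s + h y s) =
          (LINT s:{0..T}|lebesgue. h x s) + (LINT s:{0..T}|lebesgue. h y s)"
        by (intro set_integral_add hint xy)
      also have "psi \<rho> r (norm (x - y)) + \<dots> \<le> 1 + (K / \<epsilon> + K / \<epsilon>)"
        using psi_self_le_1[OF \<rho> r] hint(2)[OF xy(1)] hint(2)[OF xy(2)] by (simp add: r_def)
      also have "\<dots> \<le> ?C / \<epsilon>"
        using \<epsilon> by (simp add: field_simps)
      finally show ?thesis
        unfolding r_def[symmetric] by (intro le_psi_inv \<rho> r) auto
    qed
    show ?thesis
      using E small pair by (intro bexI[of _ E]) (auto simp: E_def A_def)
  qed
  have "\<forall>\<^sub>F \<epsilon> in at_right 0. \<exists>E \<in> sets lebesgue. E \<subseteq> ball 0 R \<and>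
             emeasure lebesgue (ball 0 R - E) \<le> ennreal \<epsilon> \<and>
             (\<forall>t\<in>{0..T}. \<forall>x\<in>E. \<forall>y\<in>E.
                ereal (norm (X t x - X t y)) \<le> psi_inv \<rho> (norm (x - y)) (?C / \<epsilon>))"
    unfolding eventually_at_right_field using main by (intro exI[of _ 1]) auto
  moreover have "?C > 0" using K by simp
  ultimately show "\<exists>C>0. \<forall>\<^sub>F \<epsilon> in at_right 0.
           \<exists>E \<in> sets lebesgue. E \<subseteq> ball 0 R \<and>
             emeasure lebesgue (ball 0 R - E) \<le> ennreal \<epsilon> \<and>
             (\<forall>t\<in>{0..T}. \<forall>x\<in>E. \<forall>y\<in>E.
                ereal (norm (X t x - X t y)) \<le> psi_inv \<rho> (norm (x - y)) (C / \<epsilon>))"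
    by (rule exI[of _ ?C, OF conjI, rotated])
qed

end
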